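(* Let $\kappa$ be any Ricci curvature, i.e. any rule assigning to each finite weighted graph and each of its edges $e$ a real number $\kappa_e$. Let $G=(V,E,\mathbf{w}_0)$ be any finite weighted graph and let $0=t_0<t_1<t_2<\cdots<t_N<t_{N+1}=+\infty$ be any partition of $[0,+\infty)$. Then there exists a continuous piecewise-linear Ricci curvature flow $\mathbf{w}(t)=(w_e(t))_{e\in E}$, $t\in[0,+\infty)$, associated with $\{t_1,\ldots,t_N\}$ and with initial condition $\mathbf{w}(0)=\mathbf{w}_0$. Furthermore, for each edge $e\in E$: 1. if $\kappa_e(t_N)=0$, then $w_e(t)=w_e(t_N)$ for all $t\geq t_N$; 2. if $\kappa_e(t_N)\neq 0$, then $$\lim_{t\to+\infty}w_e(t)=\begin{cases}0 & \text{if }\kappa_e(t_N)>0,\\ +\infty & \text{if }\kappa_e(t_N)<0.\end{cases}$$ Here $\kappa_e(t_N)$ is the Ricci curvature of the edge $e$ in the weighted graph $(V,E,\mathbf{w}(t_N))$.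
   Context: A finite weighted graph $G=(V,E,\mathbf{w})$ consists of a finite vertex set $V$, a finite edge set $E=\{e_1,\ldots,e_m\}$ and a weight vector $\mathbf{w}=(w_{e_1},\ldots,w_{e_m})\in\mathbb{R}^m_+$, where $\mathbb{R}^m_+=\{x\in\mathbb{R}^m: x_i>0 \text{ for all } i\}$. The Ricci curvature $\kappa$ is arbitrary: it is any fixed rule that assigns a real number to each edge of each finite weighted graph. Continuous piecewise-linear Ricci curvature flow: let $0=t_0<t_1<\cdots<t_N<t_{N+1}=+\infty$. A continuous function $\mathbf{w}:[0,+\infty)\to\mathbb{R}^m_+$, $\mathbf{w}(t)=(w_{e_1}(t),\ldots,w_{e_m}(t))$, is called a continuous piecewise-linear Ricci curvature flow associated with the partition $\{t_1,\ldots,t_N\}$ if (1) $\mathbf{w}(0)=\mathbf{w}_0$; (2) for each $i=1,\ldots,N+1$ and each $e\in E$, $w_e$ satisfies on $[t_{i-1},t_i)$ the linear differential equation $w_e'(t)=-\kappa_e(t_{i-1})\,w_e(t)$ with initial value $w_e(t_{i-1})$ at $t=t_{i-1}$ (the derivative at the left endpoint is one-sided, from the right), where $\kappa_e(t_{i-1})$ denotes the Ricci curvature of $e$ in the weighted graph $G(t_{i-1})=(V,E,\mathbf{w}(t_{i-1}))$. *)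

theory Defs
  imports "HOL-Analysis.Analysis"
begin

record 'v weighted_graph =
  verts :: "'v set"
  edges :: "'v set set"
  weight :: "'v set \<Rightarrow> real"

text \<open>
  An edge is an unordered pair of vertices; loops (singletons) are not excluded, so simple
  graphs are a special case.  The positive orthant of \<open>\<real>\<^sup>m\<close> is the set of positive functions
  on the edge set that are \<open>undefined\<close> off it, so that a weighted graph carries no data beyond
  its vertices, its edges and the weights of its edges.
\<close>

definition positive_weights :: "'v set set \<Rightarrow> ('v set \<Rightarrow> real) set" where
  "positive_weights E = (E \<rightarrow>\<^sub>E {0<..})"

definition finite_weighted_graph :: "'v weighted_graph \<Rightarrow> bool" where
  "finite_weighted_graph G \<longleftrightarrow>
     finite (verts G) \<and> finite (edges G) \<and>
     edges G \<subseteq> {{u, v} | u v. u \<in> verts G \<and> v \<in> verts G} \<and>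
     weight G \<in> positive_weights (edges G)"

text \<open>A Ricci curvature is an arbitrary rule; only its values on the edges of finite weighted
  graphs ever matter.\<close>

type_synonym 'v ricci_curvature = "'v weighted_graph \<Rightarrow> 'v set \<Rightarrow> real"

text \<open>The last breakpoint \<open>t\<^bsub>N+1\<^esub> = +\<infinity>\<close> is not a value of the sequence \<open>t\<close>; it
  enters through the unbounded last piece.  Values \<open>t i\<close> with \<open>i > N\<close> are irrelevant.\<close>

definition half_line_partition :: "nat \<Rightarrow> (nat \<Rightarrow> real) \<Rightarrow> bool" where
  "half_line_partition N t \<longleftrightarrow> t 0 = 0 \<and> strict_mono_on {0..N} t"

definition partition_piece :: "nat \<Rightarrow> (nat \<Rightarrow> real) \<Rightarrow> nat \<Rightarrow> real set" where
  "partition_piece N t i = (if i \<le> N then {t (i - 1)..<t i} else {t N..})"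

text \<open>
  Continuity refers to the product topology on functions, which on \<open>positive_weights (edges G)\<close>
  is the Euclidean topology.  The derivative within a piece is two-sided in the interior of the
  piece and the right derivative at its left endpoint.
\<close>

definition pl_ricci_flow ::
  "'v ricci_curvature \<Rightarrow> 'v weighted_graph \<Rightarrow> nat \<Rightarrow> (nat \<Rightarrow> real)
     \<Rightarrow> (real \<Rightarrow> 'v set \<Rightarrow> real) \<Rightarrow> bool" where
  "pl_ricci_flow \<kappa> G N t w \<longleftrightarrow>
     w ` {0..} \<subseteq> positive_weights (edges G) \<and>
     continuous_on {0..} w \<and>
     w 0 = weight G \<and>
     (\<forall>i\<in>{1..N + 1}. \<forall>e\<in>edges G. \<forall>s\<in>partition_piece N t i.
        ((\<lambda>r. w r e) has_real_derivative
           - \<kappa> (G\<lparr>weight := w (t (i - 1))\<rparr>) e * w s e) (at s within partition_piece N t i))"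

end

theory Submission
  imports Defs "HOL-Real_Asymp.Real_Asymp"
begin

text \<open>
  Freezing the curvature at weights \<open>v\<close> turns the flow into decoupled linear equations, solved
  by exponentials.  Breakpoints are added one at a time: the last, unbounded piece of a flow is
  cut at the new breakpoint and continued by the exponential solution started there.
  The limits are read off the exponential on the last piece.
\<close>

text \<open>The parameter \<open>s\<close> is the time elapsed since the weights were
  \<open>v\<close>. The restriction to \<open>edges G\<close> makes values off the edges
  \<open>undefined\<close>, as membership in \<open>positive_weights\<close> demands.\<close>

definition frozen_flow ::
  "'v ricci_curvature \<Rightarrow> 'v weighted_graph \<Rightarrow> ('v set \<Rightarrow> real) \<Rightarrow> real \<Rightarrow> 'v set \<Rightarrow> real" where
  "frozen_flow \<kappa> G v s = (\<lambda>e\<in>edges G. v e * exp (- \<kappa> (G\<lparr>weight := v\<rparr>) e * s))"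

lemma frozen_flow_0:
  "v \<in> positive_weights (edges G) \<Longrightarrow> frozen_flow \<kappa> G v 0 = v"
  by (auto simp: frozen_flow_def positive_weights_def PiE_def extensional_def)

lemma frozen_flow_positive:
  "v \<in> positive_weights (edges G) \<Longrightarrow> frozen_flow \<kappa> G v s \<in> positive_weights (edges G)"
  by (auto simp: frozen_flow_def positive_weights_def PiE_iff)

lemma continuous_on_frozen_flow: "continuous_on S (frozen_flow \<kappa> G v)"
proof (rule continuous_on_coordinatewise_then_product)
  show "continuous_on S (\<lambda>s. frozen_flow \<kappa> G v s e)" for e
    by (cases "e \<in> edges G") (auto simp: frozen_flow_def intro!: continuous_intros)
qed

text \<open>The shift \<open>c\<close> moves the starting time to an arbitrary breakpoint. Since
  \<open>S\<close> is arbitrary, the one-sided derivative at the left end of a piece is covered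
  too.\<close>

lemma frozen_flow_has_derivative:
  assumes "e \<in> edges G"
  shows "((\<lambda>r. frozen_flow \<kappa> G v (r - c) e) has_real_derivative
           - \<kappa> (G\<lparr>weight := v\<rparr>) e * frozen_flow \<kappa> G v (s - c) e) (at s within S)"
  using assms unfolding frozen_flow_def by (auto intro!: derivative_eq_intros)

lemma pl_ricci_flow_0:
  assumes "weight G \<in> positive_weights (edges G)" and "t 0 = 0"
  shows "pl_ricci_flow \<kappa> G 0 t (frozen_flow \<kappa> G (weight G))"
proof -
  have "((\<lambda>r. frozen_flow \<kappa> G (weight G) r e) has_real_derivative
      - \<kappa> (G\<lparr>weight := weight G\<rparr>) e * frozen_flow \<kappa> G (weight G) s e) (at s within S)"
    if "e \<in> edges G" for e s S
    using frozen_flow_has_derivative[OF that, of \<kappa> "weight G" 0 s S] by simp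
  then show ?thesis
    using assms
    by (auto simp: pl_ricci_flow_def frozen_flow_0 frozen_flow_positive continuous_on_frozen_flow)
qed

text \<open>The time \<open>T\<close> itself lies in the old branch, so the weights at
  \<open>T\<close>, and with them the curvature that governs the new piece, are those of
  \<open>w\<close>.\<close>

definition restart_at ::
  "'v ricci_curvature \<Rightarrow> 'v weighted_graph \<Rightarrow> real \<Rightarrow> (real \<Rightarrow> 'v set \<Rightarrow> real)
     \<Rightarrow> real \<Rightarrow> 'v set \<Rightarrow> real" where
  "restart_at \<kappa> G T w s = (if s \<le> T then w s else frozen_flow \<kappa> G (w T) (s - T))"

lemma restart_at_after:
  assumes "w T \<in> positive_weights (edges G)" and "T \<le> s"
  shows "restart_at \<kappa> G T w s = frozen_flow \<kappa> G (w T) (s - T)"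
  using assms by (auto simp: restart_at_def frozen_flow_0)

lemma half_line_partition_mono:
  assumes "half_line_partition N t" and "i \<le> j" and "j \<le> N"
  shows "t i \<le> t j"
  using assms strict_mono_on_leD[of "{0..N}" t i j] by (simp add: half_line_partition_def)

lemma half_line_partition_SucD:
  "half_line_partition (Suc N) t \<Longrightarrow> half_line_partition N t"
  by (auto simp: half_line_partition_def strict_mono_on_def)

text \<open>Pieces up to index \<open>N\<close> stay as they are; piece \<open>Suc N\<close> is the
  former unbounded piece, now cut. All of them end strictly before the restart can be felt.\<close>

lemma partition_piece_Suc:
  assumes "half_line_partition (Suc N) t" and "i \<le> Suc N"
  shows "partition_piece (Suc N) t i \<subseteq> {..<t (Suc N)} \<inter> partition_piece N t i"
proof (cases "i \<le> N")
  case True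
  have "t i \<le> t (Suc N)"
    using half_line_partition_mono[OF assms] by simp
  with True show ?thesis
    by (auto simp: partition_piece_def)
next
  case False
  with assms(2) have "i = Suc N" by simp
  then show ?thesis
    by (auto simp: partition_piece_def)
qed

text \<open>A derivative within \<open>S\<close> depends only on values in \<open>S\<close>. So
  agreement on a half-open piece suffices even at its left endpoint, where the two functions may
  differ further left.\<close>

lemma has_real_derivative_congI:
  fixes f g :: "real \<Rightarrow> real"
  assumes "(f has_real_derivative D) (at x within S)" and "x \<in> S"
    and "\<And>y. y \<in> S \<Longrightarrow> g y = f y"
  shows "(g has_real_derivative D) (at x within S)"
  using assms has_derivative_transform[of x S g f] by (auto simp: has_field_derivative_def)

text \<open>The slopes on the two sides of the new breakpoint may differ. This is harmless: pieces
  are half-open, so the breakpoint belongs to the last piece only, where the right derivative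
  counts.\<close>

lemma pl_ricci_flow_Suc:
  assumes part: "half_line_partition (Suc N) t" and flow: "pl_ricci_flow \<kappa> G N t w"
  shows "pl_ricci_flow \<kappa> G (Suc N) t (restart_at \<kappa> G (t (Suc N)) w)"
proof -
  let ?T = "t (Suc N)" and ?w = "restart_at \<kappa> G (t (Suc N)) w"
  have t0: "t 0 = 0"
    using part by (simp add: half_line_partition_def)
  have T: "?T \<ge> 0"
    using half_line_partition_mono[OF part, of 0 "Suc N"] t0 by simp
  have pos: "w s \<in> positive_weights (edges G)" if "s \<ge> 0" for s
    using flow that by (auto simp: pl_ricci_flow_def)
  \<comment> \<open>Both this formula and the next one hold at \<open>?T\<close>, because the
    exponential solution starts from \<open>w ?T\<close>; this overlap makes the two halves fit
    together.\<close>
  have after: "?w s = frozen_flow \<kappa> G (w ?T) (s - ?T)" if "s \<ge> ?T" for s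
    using restart_at_after[of w, OF pos[OF T] that] .
  have before: "?w s = w s" if "s \<le> ?T" for s
    using that by (simp add: restart_at_def)
  have "?w ` {0..} \<subseteq> positive_weights (edges G)"
    using T by (auto simp: restart_at_def pos frozen_flow_positive)
  moreover have "continuous_on {0..} ?w"
  proof -
    have "continuous_on ({0..?T} \<union> {?T..}) ?w"
    proof (rule continuous_on_closed_Un)
      have "continuous_on {0..?T} w"
        using flow by (auto simp: pl_ricci_flow_def elim: continuous_on_subset)
      then show "continuous_on {0..?T} ?w"
        by (rule continuous_on_eq) (simp add: before)
      have "continuous_on {?T..} (\<lambda>s. frozen_flow \<kappa> G (w ?T) (s - ?T))"
        by (rule continuous_on_compose2[OF continuous_on_frozen_flow[of UNIV]])
          (auto intro!: continuous_intros)
      then show "continuous_on {?T..} ?w"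
        by (rule continuous_on_eq) (simp add: after)
    qed auto
    moreover have "{0..?T} \<union> {?T..} = {0..}"
      using T by auto
    ultimately show ?thesis by simp
  qed
  moreover have "?w 0 = weight G"
    using flow T by (simp add: before pl_ricci_flow_def)
  moreover have "((\<lambda>r. ?w r e) has_real_derivative
      - \<kappa> (G\<lparr>weight := ?w (t (i - 1))\<rparr>) e * ?w s e) (at s within partition_piece (Suc N) t i)"
    if i: "i \<in> {1..Suc N + 1}" and e: "e \<in> edges G" and s: "s \<in> partition_piece (Suc N) t i"
    for i e s
  proof (cases "i \<le> Suc N")
    case True
    note sub = partition_piece_Suc[OF part True]
    \<comment> \<open>The left endpoint is not past \<open>?T\<close>, so the curvature is frozen at
      the same weights for \<open>?w\<close> as for \<open>w\<close>.\<close>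
    have ti: "t (i - 1) \<le> ?T"
      using half_line_partition_mono[OF part, of "i - 1" "Suc N"] True by simp
    have "((\<lambda>r. w r e) has_real_derivative
        - \<kappa> (G\<lparr>weight := w (t (i - 1))\<rparr>) e * w s e) (at s within partition_piece N t i)"
      using flow i e s sub True by (auto simp: pl_ricci_flow_def)
    then have deriv: "((\<lambda>r. w r e) has_real_derivative
        - \<kappa> (G\<lparr>weight := w (t (i - 1))\<rparr>) e * w s e) (at s within partition_piece (Suc N) t i)"
      by (rule DERIV_subset) (use sub in auto)
    have on_piece: "?w r = w r" if "r \<in> partition_piece (Suc N) t i" for r
      using that sub by (intro before) auto
    show ?thesis
      unfolding before[OF ti] on_piece[OF s]
      by (rule has_real_derivative_congI[OF deriv s]) (simp only: on_piece)
  next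
    case False
    \<comment> \<open>Only \<open>i = N + 2\<close> remains, the piece whose left endpoint is the
      new breakpoint.\<close>
    with i have i: "i - 1 = Suc N" "partition_piece (Suc N) t i = {?T..}"
      by (auto simp: partition_piece_def)
    from s have sT: "s \<in> {?T..}" by (simp add: i)
    have on_piece: "?w r = frozen_flow \<kappa> G (w ?T) (r - ?T)" if "r \<in> {?T..}" for r
      using that by (intro after) simp
    show ?thesis
      unfolding i before[OF order_refl] on_piece[OF sT]
      by (rule has_real_derivative_congI[OF frozen_flow_has_derivative[OF e] sT])
        (simp only: on_piece)
  qed
  ultimately show ?thesis
    by (simp add: pl_ricci_flow_def)
qed

text \<open>The explicit formula on the last piece is recorded because the limits are read off it;
  this avoids a uniqueness argument for the linear equation.\<close>

lemma pl_ricci_flow_exists: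
  assumes "weight G \<in> positive_weights (edges G)" and "half_line_partition N t"
  shows "\<exists>w. pl_ricci_flow \<kappa> G N t w \<and> (\<forall>s\<ge>t N. w s = frozen_flow \<kappa> G (w (t N)) (s - t N))"
  using assms(2)
proof (induction N)
  case 0
  then have "t 0 = 0"
    by (simp add: half_line_partition_def)
  with pl_ricci_flow_0[of G t, OF assms(1) this] show ?case
    by (intro exI[of _ "frozen_flow \<kappa> G (weight G)"]) (simp add: frozen_flow_0 assms(1))
next
  case (Suc N)
  then obtain w where w: "pl_ricci_flow \<kappa> G N t w"
    using half_line_partition_SucD by blast
  have "0 \<le> t (Suc N)"
    using half_line_partition_mono[OF Suc.prems, of 0 "Suc N"] Suc.prems
    by (simp add: half_line_partition_def)
  with w have "w (t (Suc N)) \<in> positive_weights (edges G)"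
    by (auto simp: pl_ricci_flow_def)
  then show ?case
    using pl_ricci_flow_Suc[OF Suc.prems w]
    by (intro exI[of _ "restart_at \<kappa> G (t (Suc N)) w"])
      (simp add: restart_at_after frozen_flow_0)
qed

lemma exp_decay_at_top:
  fixes a b k :: real
  assumes "k > 0"
  shows "((\<lambda>s. a * exp (- k * (s - b))) \<longlongrightarrow> 0) at_top"
  using assms by real_asymp

lemma exp_growth_at_top:
  fixes a b k :: real
  assumes "a > 0" and "k < 0"
  shows "filterlim (\<lambda>s. a * exp (- k * (s - b))) at_top at_top"
  using assms by real_asymp

theorem theorem2p1:
  fixes \<kappa> :: "'v ricci_curvature"
    and G :: "'v weighted_graph"
    and N :: nat
    and t :: "nat \<Rightarrow> real"
  assumes "finite_weighted_graph G"
    and "half_line_partition N t"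
  shows "\<exists>w. pl_ricci_flow \<kappa> G N t w \<and>
    (\<forall>e\<in>edges G.
      (\<kappa> (G\<lparr>weight := w (t N)\<rparr>) e = 0 \<longrightarrow> (\<forall>s\<ge>t N. w s e = w (t N) e)) \<and>
      (\<kappa> (G\<lparr>weight := w (t N)\<rparr>) e > 0 \<longrightarrow> ((\<lambda>s. w s e) \<longlongrightarrow> 0) at_top) \<and>
      (\<kappa> (G\<lparr>weight := w (t N)\<rparr>) e < 0 \<longrightarrow> filterlim (\<lambda>s. w s e) at_top at_top))"
proof -
  have "weight G \<in> positive_weights (edges G)"
    using assms(1) by (simp add: finite_weighted_graph_def)
  from pl_ricci_flow_exists[OF this assms(2), of \<kappa>] obtain w
    where flow: "pl_ricci_flow \<kappa> G N t w"
      and last: "\<And>s. s \<ge> t N \<Longrightarrow> w s = frozen_flow \<kappa> G (w (t N)) (s - t N)"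
    by blast
  have "t N \<ge> 0"
    using half_line_partition_mono[OF assms(2), of 0 N] assms(2)
    by (simp add: half_line_partition_def)
  with flow have "w (t N) \<in> positive_weights (edges G)"
    by (auto simp: pl_ricci_flow_def)
  \<comment> \<open>Positivity of the weight at \<open>t N\<close> is what makes the growing
    exponential tend to plus infinity.\<close>
  then have pos: "w (t N) e > 0" if "e \<in> edges G" for e
    using that by (auto simp: positive_weights_def)
  let ?k = "\<kappa> (G\<lparr>weight := w (t N)\<rparr>)"
  have last': "w s e = w (t N) e * exp (- ?k e * (s - t N))" if "e \<in> edges G" "s \<ge> t N" for e s
    using that(1) by (subst last[OF that(2)]) (simp add: frozen_flow_def)
  \<comment> \<open>The formula holds only from \<open>t N\<close> on, but limits at infinity see no
    more than that.\<close>
  have ev: "\<forall>\<^sub>F s in at_top. w s e = w (t N) e * exp (- ?k e * (s - t N))"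
    if "e \<in> edges G" for e
    using eventually_ge_at_top[of "t N"] by (rule eventually_mono) (rule last'[OF that])
  show ?thesis
  proof (intro exI[of _ w] conjI ballI impI allI)
    fix e assume e: "e \<in> edges G"
    show "w s e = w (t N) e" if "?k e = 0" "s \<ge> t N" for s
      using last'[OF e that(2)] that(1) by simp
    show "((\<lambda>s. w s e) \<longlongrightarrow> 0) at_top" if "?k e > 0"
      using exp_decay_at_top[OF that] tendsto_cong[OF ev[OF e]] by blast
    show "filterlim (\<lambda>s. w s e) at_top at_top" if "?k e < 0"
      using exp_growth_at_top[OF pos[OF e] that] filterlim_cong[OF refl refl ev[OF e]] by blast
  qed (rule flow)
qed

end
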